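(* Let $p\ge 2$ be an integer. (i) For every $l\in\{0,1,\dots,p+1\}$ and every $Q\in\Delta^\gamma_{0,l}$, the set $Q+\mathscr{C}_{2^p}$ is a $2^{2p+2}\sqrt n$-admissible Whitney set. (ii) For every $i\in\{1,\dots,2^{p+4}\}^n$, the set $A_p^{(i)}+\mathscr{C}_{2^p}$ is a $2^{p+3}\sqrt n$-admissible Whitney set.
   Context: Fix a dimension $n\ge 1$; $|\cdot|$ is the Euclidean norm on $\mathbb{R}^n$, $d$ the Euclidean distance (between points, or between a point and a set), $\complement A$ the complement of $A$ in $\mathbb{R}^n$, and $B(x,r)=\{y\in\mathbb{R}^n:|x-y|<r\}$. Put $m(x)=\min\{1,1/|x|\}$ for $x\in\mathbb{R}^n$ (with $m(0)=1$). For $\alpha>0$ let $\mathscr{B}_\alpha=\{B(x,r): x\in\mathbb{R}^n,\ 0\le r\le\alpha m(x)\}$. For $A\subseteq\mathbb{R}^n$ write $$A+\mathscr{C}_\alpha=\{z\in\mathbb{R}^n: z\text{ is the centre of a ball }B\in\mathscr{B}_\alpha\text{ that intersects }A\}.$$ Dyadic cubes: for $m\in\mathbb{Z}$, $\Delta_m=\{2^{-m}(x+[0,1)^n): x\in\mathbb{Z}^n\}$. Layers: $L_0=[-1,1)^n$ and $L_l=[-2^l,2^l)^n\setminus[-2^{l-1},2^{l-1})^n$ for integers $l\ge1$. For $k\in\mathbb{Z}$ and $l\ge0$, $\Delta^\gamma_{k,l}=\{Q\in\Delta_{l+k}: Q\subseteq L_l\}$. Labels: put $\kappa=p+4$. For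 each integer $l\ge\lceil\frac{\kappa+1}{2}\rceil$ the layer $L_l$ is a disjoint union of cubes in $\Delta^\gamma_{-\kappa,l}$, each of which is the disjoint union of $2^{\kappa n}$ cubes from $\Delta^\gamma_{0,l}$. Each of these smaller cubes is labelled by its position $i=(i_1,\dots,i_n)\in\{1,\dots,2^\kappa\}^n$ inside the larger cube: the cube $2^{-l}\big(2^\kappa y+(i_1-1,\dots,i_n-1)+[0,1)^n\big)$, contained in the larger cube $2^{\kappa-l}(y+[0,1)^n)$ with $y\in\mathbb{Z}^n$, has label $i$. (All $l\ge p+2$ satisfy $l\ge\lceil\frac{\kappa+1}{2}\rceil$.) For $i\in\{1,\dots,2^{p+4}\}^n$, $A_p^{(i)}$ is the union of all cubes in $\bigcup_{l\ge p+2}\Delta^\gamma_{0,l}$ with label $i$. For $\lambda>0$, a set $A\subseteq\mathbb{R}^n$ is a $\lambda$-admissible Whitney set if $d(x,\complement A)\le\lambda m(x)$ for all $x\in A$. *)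

theory Defs
  imports "HOL-Analysis.Analysis"
begin

definition gauss_m :: "real ^ 'n \<Rightarrow> real" where
  "gauss_m x = (if x = 0 then 1 else min 1 (1 / norm x))"

definition admissible_balls :: "real \<Rightarrow> (real ^ 'n) set set" where
  "admissible_balls \<alpha> = {ball x r | x r. 0 \<le> r \<and> r \<le> \<alpha> * gauss_m x}"

text \<open>The set \<open>A + C\<^sub>\<alpha>\<close>. The degenerate balls of radius 0 are empty and contribute nothing;
  a nonempty ball has only one centre.\<close>
definition plus_C :: "(real ^ 'n) set \<Rightarrow> real \<Rightarrow> (real ^ 'n) set" where
  "plus_C A \<alpha> = {z. \<exists>B \<in> admissible_balls \<alpha>. (\<exists>r. B = ball z r) \<and> B \<inter> A \<noteq> {}}"

definition dyadic_cube :: "int \<Rightarrow> int ^ 'n \<Rightarrow> (real ^ 'n) set" where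
  "dyadic_cube m x =
     (\<lambda>u. (2 powi (- m)) *\<^sub>R ((\<chi> j. real_of_int (x $ j)) + u)) ` {u. \<forall>j. 0 \<le> u $ j \<and> u $ j < 1}"

definition dyadic_cubes :: "int \<Rightarrow> (real ^ 'n) set set" where
  "dyadic_cubes m = range (dyadic_cube m)"

definition centred_cube :: "real \<Rightarrow> (real ^ 'n) set" where
  "centred_cube a = {z. \<forall>j. - a \<le> z $ j \<and> z $ j < a}"

definition layer :: "nat \<Rightarrow> (real ^ 'n) set" where
  "layer l = (if l = 0 then centred_cube 1 else centred_cube (2 ^ l) - centred_cube (2 ^ (l - 1)))"

definition gauss_cubes :: "int \<Rightarrow> nat \<Rightarrow> (real ^ 'n) set set" where
  "gauss_cubes k l = {Q \<in> dyadic_cubes (int l + k). Q \<subseteq> layer l}"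

text \<open>\<open>has_label \<kappa> l i Q\<close>: the cube \<open>Q\<close> of side \<open>2\<^sup>-\<^sup>l\<close> has position \<open>i\<close> (coordinates counted from 1)
  in the cube \<open>dyadic_cube (int l - int \<kappa>) y\<close> of side \<open>2\<^sup>\<kappa>\<^sup>-\<^sup>l\<close>. This is used only for
  \<open>i\<close> with coordinates in \<open>{1..2 ^ \<kappa>}\<close>, and for such \<open>i\<close> the larger cube contains \<open>Q\<close>.\<close>
definition has_label :: "nat \<Rightarrow> nat \<Rightarrow> int ^ 'n \<Rightarrow> (real ^ 'n) set \<Rightarrow> bool" where
  "has_label \<kappa> l i Q \<longleftrightarrow>
     (\<exists>y :: int ^ 'n. Q = dyadic_cube (int l) (\<chi> j. 2 ^ \<kappa> * y $ j + (i $ j - 1)))"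

definition label_union :: "nat \<Rightarrow> int ^ 'n \<Rightarrow> (real ^ 'n) set" where
  "label_union p i = \<Union> {Q. \<exists>l \<ge> p + 2. Q \<in> gauss_cubes 0 l \<and> has_label (p + 4) l i Q}"

text \<open>The distance to the empty set is infinite, so the whole space is not admissible, whereas
  \<^const>\<open>infdist\<close> takes the value 0 there; hence the nonemptiness requirement.\<close>
definition admissible_whitney :: "real \<Rightarrow> (real ^ 'n) set \<Rightarrow> bool" where
  "admissible_whitney lam A \<longleftrightarrow> (\<forall>x \<in> A. - A \<noteq> {} \<and> infdist x (- A) \<le> lam * gauss_m x)"

end

theory Submission
  imports Defs
begin

text \<open>
  To see that \<open>A + C\<^sub>\<alpha>\<close> is Whitney admissible, each of its points \<open>x\<close> needs a point \<open>z\<close> outside at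
  controlled distance.  Here \<open>z\<close> is outside exactly if no point of \<open>A\<close> has distance less than
  \<open>\<alpha> m(z)\<close> from it.  In both parts \<open>z\<close> is found by moving \<open>x\<close> parallel to one coordinate axis \<open>j\<close>,
  away from the hyperplane \<open>x\<^sub>j = 0\<close>.  Such a move increases the norm, so \<open>m\<close> does not increase, and
  the distance from \<open>z\<close> to \<open>A\<close> can be estimated by its \<open>j\<close>-th coordinate alone.

  For a single cube \<open>Q\<close> of side \<open>2\<^sup>-\<^sup>l\<close>, a move by \<open>2 \<cdot> 2\<^sup>p m(x) + 2\<^sup>-\<^sup>l\<close> is long enough: it
  crosses the cube and clears the two radii.  It is also short enough, because \<open>Q\<close> lies in
  \<open>[-2\<^sup>l, 2\<^sup>l)\<^sup>n\<close>, which makes \<open>2\<^sup>-\<^sup>l\<close> at most a multiple of \<open>m(x)\<close>.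

  For the union of all cubes with label \<open>i\<close>, let \<open>j\<close> be a coordinate in which \<open>\<bar>x\<^sub>j\<bar> = M\<close> is maximal
  and put \<open>R = 2\<^sup>p / M\<close>, which bounds the radius \<open>2\<^sup>p m\<close> at all points under consideration.
  After a move by at least \<open>2 R\<close> the \<open>j\<close>-th coordinate dominates at every point of the set that is
  close to \<open>z\<close>; hence this coordinate alone determines the layer, and the problem becomes
  one-dimensional.  On the axis the labelled cubes leave short intervals, of length \<open>2\<^sup>-\<^sup>l\<close>,
  separated by gaps of length at least \<open>(2\<^sup>p\<^sup>+\<^sup>4 - 1) 2\<^sup>-\<^sup>l\<close>, where \<open>l\<close> belongs to the outer of the two
  neighbours; lemma \<open>axis_label_gap\<close> shows that this includes gaps across the border between two layers.
  Two candidates are tested, \<open>t = 2 R\<close> and \<open>t = 4 R + 1 / M\<close>.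
  If both end points were in the enlarged set, the set would have points nearby whose \<open>j\<close>-th
  coordinates are too far apart for one interval and too close together for two different ones.
  Since \<open>4 R + 1 / M \<le> 8 R\<close> and \<open>\<bar>x\<bar> \<le> \<surd>n M\<close>, the successful candidate is within
  \<open>2\<^sup>p\<^sup>+\<^sup>3 \<surd>n m(x)\<close> of \<open>x\<close>.
\<close>

section \<open>The weight and the enlargement of a set\<close>

lemma gauss_m_pos: "gauss_m x > 0"
  by (simp add: gauss_m_def)

lemma gauss_m_le_1: "gauss_m x \<le> 1"
  by (simp add: gauss_m_def)

lemma gauss_m_antimono: "norm x \<le> norm y \<Longrightarrow> gauss_m y \<le> gauss_m x"
  by (auto simp: gauss_m_def min_le_iff_disj frac_le)

lemma gauss_m_eq_inverse_norm: "1 \<le> norm x \<Longrightarrow> gauss_m x = 1 / norm x"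
  by (auto simp: gauss_m_def min_def)

text \<open>A nonempty ball determines its centre and radius, so enlarging by balls amounts to a
  condition on distances.\<close>

lemma mem_plus_C_iff: "z \<in> plus_C A \<alpha> \<longleftrightarrow> (\<exists>a\<in>A. dist z a < \<alpha> * gauss_m z)"
proof
  assume "z \<in> plus_C A \<alpha>"
  then obtain x r r' a where "ball x r' = ball z r" "r' \<le> \<alpha> * gauss_m x" "a \<in> A" "a \<in> ball z r"
    unfolding plus_C_def admissible_balls_def by blast
  moreover from this have "r > 0"
    by (metis ball_eq_empty empty_iff not_le)
  ultimately have "x = z" "r' = r"
    by (auto simp: ball_eq_ball_iff)
  with \<open>r' \<le> _\<close> \<open>a \<in> A\<close> \<open>a \<in> ball z r\<close> show "\<exists>a\<in>A. dist z a < \<alpha> * gauss_m z"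
    by (auto intro!: bexI[of _ a])
next
  assume "\<exists>a\<in>A. dist z a < \<alpha> * gauss_m z"
  then obtain a where a: "a \<in> A" "dist z a < \<alpha> * gauss_m z" by blast
  from a(2) have "0 \<le> \<alpha> * gauss_m z"
    using zero_le_dist[of z a] by linarith
  then have "ball z (\<alpha> * gauss_m z) \<in> admissible_balls \<alpha>"
    unfolding admissible_balls_def by blast
  moreover have "a \<in> ball z (\<alpha> * gauss_m z) \<inter> A" using a by simp
  ultimately show "z \<in> plus_C A \<alpha>"
    unfolding plus_C_def by blast
qed

lemma admissible_whitneyI:
  assumes "\<And>x. x \<in> A \<Longrightarrow> \<exists>z. z \<notin> A \<and> dist x z \<le> lam * gauss_m x"
  shows "admissible_whitney lam A"
  unfolding admissible_whitney_def
proof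
  fix x assume "x \<in> A"
  from assms[OF this] obtain z where z: "z \<in> - A" "dist x z \<le> lam * gauss_m x" by blast
  from infdist_le[OF z(1), of x] z show "- A \<noteq> {} \<and> infdist x (- A) \<le> lam * gauss_m x" by auto
qed

section \<open>Coordinates\<close>

lemma norm_le_sqrt_card_mult:
  fixes x :: "real ^ 'n"
  assumes "\<And>k. \<bar>x $ k\<bar> \<le> M"
  shows "norm x \<le> sqrt (real CARD('n)) * M"
proof -
  have M: "0 \<le> M" using assms[of undefined] by linarith
  have "(\<Sum>k\<in>UNIV. (x $ k)\<^sup>2) \<le> (\<Sum>k\<in>(UNIV :: 'n set). M\<^sup>2)"
    by (intro sum_mono) (use assms M in \<open>simp add: abs_le_square_iff[symmetric]\<close>)
  then have "norm x \<le> sqrt (real CARD('n) * M\<^sup>2)"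
    by (simp add: norm_vec_def L2_set_def)
  with M show ?thesis by (simp add: real_sqrt_mult)
qed

lemma dist_ge_component: "\<bar>x $ k - y $ k\<bar> \<le> dist x (y :: real ^ 'n)"
  by (metis component_le_norm_cart dist_norm vector_minus_component)

text \<open>The translation that increases \<open>\<bar>x\<^sub>j\<bar>\<close> by \<open>t\<close>.  For \<open>x\<^sub>j = 0\<close> either direction would do;
  the positive one is chosen.\<close>

definition outward :: "'n \<Rightarrow> real \<Rightarrow> real ^ 'n \<Rightarrow> real ^ 'n" where
  "outward j t x = x + axis j (if 0 \<le> x $ j then t else - t)"

lemma outward_nth: "outward j t x $ k = 
    (if k = j then x $ j + (if 0 \<le> x $ j then t else - t) else x $ k)"
  by (simp add: outward_def axis_def)

lemma dist_outward:
  assumes "0 \<le> t"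
  shows "dist x (outward j t x) = t"
proof -
  have "axis j c = c *\<^sub>R axis j (1::real)" for c
    by (simp add: vec_eq_iff axis_def)
  then have "norm (axis j c) = \<bar>c\<bar>" for c :: real
    by (metis norm_axis_1 norm_scaleR mult.right_neutral)
  with assms show ?thesis by (simp add: outward_def dist_norm)
qed

lemma norm_le_norm_outward:
  assumes "0 \<le> t"
  shows "norm x \<le> norm (outward j t x)"
  by (rule norm_le_componentwise_cart) (use assms in \<open>simp add: outward_nth\<close>)

lemma mem_dyadic_cube_iff:
  "a \<in> dyadic_cube m w \<longleftrightarrow>
     (\<forall>j. real_of_int (w $ j) \<le> 2 powi m * a $ j \<and> 2 powi m * a $ j < real_of_int (w $ j) + 1)"
  (is "_ \<longleftrightarrow> ?R")
proof
  assume "a \<in> dyadic_cube m w"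
  then show ?R
    by (auto simp: dyadic_cube_def power_int_minus field_simps)
next
  assume R: ?R
  have "a = (2 powi (- m)) *\<^sub>R ((\<chi> j. real_of_int (w $ j)) + (\<chi> j. 2 powi m * a $ j - real_of_int (w $ j)))"
    by (simp add: vec_eq_iff power_int_minus field_simps)
  then show "a \<in> dyadic_cube m w"
    unfolding dyadic_cube_def by (rule image_eqI) (use R in \<open>simp add: algebra_simps\<close>)
qed

section \<open>A single cube\<close>

text \<open>The move by \<open>t\<close> outweighs the width of \<open>Q\<close> in one coordinate plus the radii at \<open>x\<close> and at the
  end point.  It is bounded by a multiple of \<open>m(x)\<close> because \<open>x\<close> is at most
  \<open>2\<^sup>p\<close> away from \<open>[-2\<^sup>l, 2\<^sup>l)\<^sup>n\<close>: this gives \<open>2\<^sup>-\<^sup>l \<le> (\<surd>n + 2\<^sup>p) m(x)\<close>.\<close>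

lemma gauss_cube_admissible:
  fixes Q :: "(real ^ 'n) set"
  assumes Q: "Q \<in> gauss_cubes 0 l"
  shows "admissible_whitney (2 ^ (2 * p + 2) * sqrt (real CARD('n))) (plus_C Q (2 ^ p))"
proof (rule admissible_whitneyI)
  fix x assume "x \<in> plus_C Q (2 ^ p)"
  then obtain a where a: "a \<in> Q" "dist x a < 2 ^ p * gauss_m x"
    by (auto simp: mem_plus_C_iff)
  let ?m = "gauss_m x" and ?u = "1 / 2 ^ l :: real" and ?s = "sqrt (real CARD('n))" and ?q = "2 ^ p :: real"
  have u: "0 < ?u" "?u \<le> 1" by simp_all
  have s1: "1 \<le> ?s" by (simp add: Suc_le_eq)
  have q1: "1 \<le> ?q" by simp
  obtain w where w: "Q = dyadic_cube (int l) w" and lay: "Q \<subseteq> layer l"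
    using Q by (auto simp: gauss_cubes_def dyadic_cubes_def)
  have "\<bar>a $ k\<bar> \<le> 2 ^ l" for k
    using lay a(1) by (auto simp: layer_def centred_cube_def abs_le_iff subset_iff split: if_splits 
      dest!: spec[of _ k] bspec[of _ _ a])
  then have na: "norm a \<le> ?s * 2 ^ l" by (rule norm_le_sqrt_card_mult)
  have side: "?u \<le> (?s + ?q) * ?m"
  proof (cases "norm x \<le> 1")
    case True
    then have "?m = 1" by (auto simp: gauss_m_def min_def)
    moreover have "?u \<le> ?s + ?q" using u s1 q1 by linarith
    ultimately show ?thesis by simp
  next
    case False
    then have m: "?m = 1 / norm x" by (simp add: gauss_m_eq_inverse_norm)
    have "norm x \<le> norm a + dist x a" by (simp add: dist_norm norm_triangle_sub)
    also have "\<dots> \<le> ?s * 2 ^ l + ?q * ?m" using na a(2) by linarith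
    also have "?q * ?m \<le> ?q * 2 ^ l"
      using gauss_m_le_1[of x] by (intro mult_left_mono) (auto intro: order_trans[of _ 1])
    finally have "norm x \<le> (?s + ?q) * 2 ^ l" by (simp add: algebra_simps)
    then have "1 / 2 ^ l * norm x \<le> ?s + ?q" by (simp add: divide_le_eq)
    moreover have "0 < norm x" using False by linarith
    ultimately show ?thesis unfolding m by (simp only: times_divide_eq_right mult_1_right pos_le_divide_eq)
  qed
  define t where "t = 2 * ?q * ?m + ?u"
  have t0: "0 \<le> t" unfolding t_def using gauss_m_pos[of x] by simp
  \<comment> \<open>The coordinate is arbitrary: measured along a single axis, \<open>Q\<close> has width \<open>?u\<close> without
    the factor \<open>?s\<close> that its diameter carries.\<close>
  obtain j :: 'n where True by blast
  define z where "z = outward j t x"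
  have "z \<notin> plus_C Q (2 ^ p)"
  proof
    assume "z \<in> plus_C Q (2 ^ p)"
    then obtain b where b: "b \<in> Q" "dist z b < ?q * gauss_m z"
      by (auto simp: mem_plus_C_iff)
    have "gauss_m z \<le> ?m"
      unfolding z_def by (intro gauss_m_antimono norm_le_norm_outward t0)
    then have "?q * gauss_m z \<le> ?q * ?m" by simp
    with b(2) have "\<bar>z $ j - b $ j\<bar> < ?q * ?m" using dist_ge_component[of z j b] by linarith
    moreover have "\<bar>x $ j - a $ j\<bar> < ?q * ?m"
      using a(2) dist_ge_component[of x j a] by linarith
    moreover have "\<bar>2 ^ l * a $ j - 2 ^ l * b $ j\<bar> < 1"
      using a(1) b(1) unfolding w mem_dyadic_cube_iff by (force simp: abs_less_iff dest!: spec[of _ j])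
    then have "2 ^ l * \<bar>a $ j - b $ j\<bar> < 1"
      by (simp add: abs_mult flip: right_diff_distrib)
    then have "\<bar>a $ j - b $ j\<bar> < ?u" by (simp add: field_simps)
    moreover have "\<bar>z $ j - x $ j\<bar> = t" using t0 by (simp add: z_def outward_nth)
    ultimately show False unfolding t_def by linarith
  qed
  moreover have "dist x z \<le> 2 ^ (2 * p + 2) * ?s * ?m"
  proof -
    have "t \<le> (3 * ?q + ?s) * ?m" using side by (simp add: t_def algebra_simps)
    also have "\<dots> \<le> (2 ^ (2 * p + 2) * ?s) * ?m"
    proof (rule mult_right_mono)
      have qq: "?q \<le> ?q * ?q" using q1 by simp
      have "?q * 1 \<le> (?q * ?q) * ?s" using qq s1 by (intro mult_mono) auto
      moreover have "1 * ?s \<le> (?q * ?q) * ?s" using qq q1 s1 by (intro mult_right_mono) linarith+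
      ultimately have "3 * ?q + ?s \<le> 4 * (?q * ?q) * ?s" by linarith
      also have "4 * (?q * ?q) = (2::real) ^ 2 * (2 ^ p * 2 ^ p)" by simp
      also have "\<dots> = 2 ^ (2 * p + 2)"
        unfolding mult_2 power_add by (rule mult.commute)
      finally show "3 * ?q + ?s \<le> 2 ^ (2 * p + 2) * ?s" .
    qed (use gauss_m_pos[of x] in simp)
    finally show ?thesis using t0 by (simp add: z_def dist_outward)
  qed
  ultimately show "\<exists>z. z \<notin> plus_C Q (2 ^ p) \<and> dist x z \<le> 2 ^ (2 * p + 2) * ?s * ?m" by blast
qed

section \<open>Gaps between equally labelled cubes on a coordinate axis\<close>

text \<open>The projections of the cubes of side \<open>2\<^sup>-\<^sup>l\<close> with a given label: the number \<open>s\<close> lies in a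
  dyadic interval of length \<open>2\<^sup>-\<^sup>l\<close> whose index is congruent to \<open>c\<close> modulo \<open>2\<^sup>\<kappa>\<close>.\<close>

definition axis_label :: "nat \<Rightarrow> int \<Rightarrow> nat \<Rightarrow> real \<Rightarrow> bool" where
  "axis_label \<kappa> c l s \<longleftrightarrow>
     (\<exists>y :: int. real_of_int (2 ^ \<kappa> * y + c) \<le> 2 ^ l * s \<and> 2 ^ l * s < real_of_int (2 ^ \<kappa> * y + c) + 1)"

text \<open>The next two lemmas locate labelled points relative to a border \<open>b\<close> between two blocks of
  \<open>2\<^sup>\<kappa>\<close> consecutive intervals: each block contributes only its interval in position \<open>c\<close>,
  which leaves \<open>2\<^sup>\<kappa> - c - 1\<close> intervals above it and \<open>c\<close> intervals below it.\<close>

lemma axis_label_below_multiple: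
  assumes "axis_label \<kappa> c l s" "0 \<le> c" "2 ^ l * b = real_of_int (2 ^ \<kappa> * a)" "s < b"
  shows "2 ^ l * (b - s) > 2 ^ \<kappa> - real_of_int c - 1"
proof -
  obtain y :: int where y: "real_of_int (2 ^ \<kappa> * y + c) \<le> 2 ^ l * s" "2 ^ l * s < real_of_int (2 ^ \<kappa> * y + c) + 1"
    using assms(1) by (auto simp: axis_label_def)
  have "2 ^ l * s < 2 ^ l * b" using assms(4) by simp
  with y(1) assms(3) have "real_of_int (2 ^ \<kappa> * y + c) < real_of_int (2 ^ \<kappa> * a)" by linarith
  then have "2 ^ \<kappa> * y + c < 2 ^ \<kappa> * a" by (simp only: of_int_less_iff)
  with assms(2) have "2 ^ \<kappa> * y < 2 ^ \<kappa> * a" by linarith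
  then have "y \<le> a - 1" by simp
  then have "2 ^ \<kappa> * y \<le> 2 ^ \<kappa> * (a - 1)" by (intro mult_left_mono) auto
  then have "real_of_int (2 ^ \<kappa> * y) \<le> real_of_int (2 ^ \<kappa> * (a - 1))" by (simp only: of_int_le_iff)
  with y(2) assms(3) show ?thesis by (simp add: algebra_simps)
qed

lemma axis_label_above_multiple:
  assumes "axis_label \<kappa> c l s" "c < 2 ^ \<kappa>" "2 ^ l * b = real_of_int (2 ^ \<kappa> * a)" "b \<le> s"
  shows "2 ^ l * (s - b) \<ge> real_of_int c"
proof -
  obtain y :: int where y: "real_of_int (2 ^ \<kappa> * y + c) \<le> 2 ^ l * s" "2 ^ l * s < real_of_int (2 ^ \<kappa> * y + c) + 1"
    using assms(1) by (auto simp: axis_label_def)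
  have "2 ^ l * b \<le> 2 ^ l * s" using assms(4) by simp
  with y(2) assms(3) have "real_of_int (2 ^ \<kappa> * a) < real_of_int (2 ^ \<kappa> * y + c + 1)" by simp
  then have "2 ^ \<kappa> * a < 2 ^ \<kappa> * y + c + 1" by (simp only: of_int_less_iff)
  with assms(2) have "2 ^ \<kappa> * a < 2 ^ \<kappa> * (y + 1)" by (simp add: algebra_simps)
  then have "a \<le> y" by simp
  then have "2 ^ \<kappa> * a \<le> 2 ^ \<kappa> * y" by (intro mult_left_mono) auto
  then have "real_of_int (2 ^ \<kappa> * a) \<le> real_of_int (2 ^ \<kappa> * y)" by (simp only: of_int_le_iff)
  with y(1) assms(3) have "real_of_int c \<le> 2 ^ l * s - 2 ^ l * b" unfolding of_int_add by linarith
  then show ?thesis by (simp add: right_diff_distrib)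
qed

text \<open>The trace of the layer on a coordinate axis.\<close>

definition axis_layer :: "nat \<Rightarrow> real \<Rightarrow> bool" where
  "axis_layer l s \<longleftrightarrow> - (2 ^ l) \<le> s \<and> s < 2 ^ l \<and> \<not> (- (2 ^ (l - 1)) \<le> s \<and> s < 2 ^ (l - 1))"

lemma axis_label_gap_same_layer:
  assumes "axis_label \<kappa> c l s" "axis_label \<kappa> c l s'"
  shows "2 ^ l * \<bar>s' - s\<bar> < 1 \<or> 2 ^ l * \<bar>s' - s\<bar> > 2 ^ \<kappa> - 1"
proof -
  obtain y y' :: int where y: "real_of_int (2 ^ \<kappa> * y + c) \<le> 2 ^ l * s" "2 ^ l * s < real_of_int (2 ^ \<kappa> * y + c) + 1"
    and y': "real_of_int (2 ^ \<kappa> * y' + c) \<le> 2 ^ l * s'" "2 ^ l * s' < real_of_int (2 ^ \<kappa> * y' + c) + 1"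
    using assms by (auto simp: axis_label_def)
  have eq: "2 ^ l * \<bar>s' - s\<bar> = \<bar>2 ^ l * s' - 2 ^ l * s\<bar>"
    by (simp add: abs_mult flip: right_diff_distrib)
  have far: "real_of_int (2 ^ \<kappa> * b) - real_of_int (2 ^ \<kappa> * a) \<ge> 2 ^ \<kappa>" if "a < b" for a b :: int
  proof -
    have "(2::int) ^ \<kappa> * (a + 1) \<le> 2 ^ \<kappa> * b" using that by (intro mult_left_mono) auto
    then have "real_of_int (2 ^ \<kappa> * (a + 1)) \<le> real_of_int (2 ^ \<kappa> * b)" by (simp only: of_int_le_iff)
    then show ?thesis by (simp add: algebra_simps)
  qed
  consider "y = y'" | "y < y'" | "y' < y" by linarith
  then show ?thesis
  proof cases
    case 1 then show ?thesis unfolding eq using y y' by (simp add: abs_less_iff)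
  next
    case 2 from far[OF this] y y' show ?thesis unfolding eq of_int_add by linarith
  next
    case 3 from far[OF this] y y' show ?thesis unfolding eq of_int_add by linarith
  qed
qed

text \<open>Points of different layers are separated by the border \<open>b = \<plusminus>2\<^sup>l\<^sup>'\<^sup>-\<^sup>1\<close> of the outer layer \<open>l'\<close>.
  The condition \<open>\<kappa> + 1 \<le> 2 l\<close> makes the borders of the layer \<open>l\<close> multiples of the block length
  \<open>2\<^sup>\<kappa>\<^sup>-\<^sup>l\<close>, so the position \<open>c\<close> prescribes the clearance on either side of them.  On the positive
  half axis it is at least \<open>2\<^sup>\<kappa> - c - 1\<close> inner intervals on the inner side and \<open>c\<close> outer
  intervals on the outer side; on the negative half axis the two numbers change places.  As an inner
  interval is at least twice as long as an outer one, the total is at least \<open>2\<^sup>\<kappa> - 1\<close> outer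
  intervals for every \<open>c\<close>.\<close>

lemma axis_label_gap:
  assumes lab: "axis_label \<kappa> c l s" "axis_label \<kappa> c l' s'"
    and lay: "axis_layer l s" "axis_layer l' s'"
    and l: "\<kappa> + 1 \<le> 2 * l" "\<kappa> + 1 \<le> 2 * l'"
    and c: "0 \<le> c" "c < 2 ^ \<kappa>"
    and sgn: "0 \<le> s \<longleftrightarrow> 0 \<le> s'" and less: "\<bar>s\<bar> < \<bar>s'\<bar>"
  shows "2 ^ l' * \<bar>s' - s\<bar> < 1 \<or> 2 ^ l' * \<bar>s' - s\<bar> > 2 ^ \<kappa> - 1"
proof (cases "l = l'")
  case True
  with axis_label_gap_same_layer[of \<kappa> c l' s s'] lab show ?thesis by blast
next
  case False
  have cN: "real_of_int c \<le> 2 ^ \<kappa> - 1"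
  proof -
    have "real_of_int c \<le> real_of_int (2 ^ \<kappa> - 1)" using c(2) by (simp only: of_int_le_iff)
    then show ?thesis by simp
  qed
  have "(2::real) ^ (l - 1) < 2 ^ l'"
    using lay less unfolding axis_layer_def by linarith
  then have "l - 1 < l'" by simp
  with False have ll: "l \<le> l' - 1" "l < l'" by auto
  have bb: "(2::real) ^ l \<le> 2 ^ (l' - 1)" using ll(1) by simp
  have "(2::real) ^ Suc l \<le> 2 ^ l'" using ll(2) by (intro power_increasing) auto
  then have scale: "2 * (2 ^ l * d) \<le> 2 ^ l' * d" if "0 \<le> d" for d :: real
    using mult_right_mono[OF _ that] by fastforce
  have mult: "2 ^ l * 2 ^ l = real_of_int (2 ^ \<kappa> * 2 ^ (2 * l - \<kappa>))"
  proof -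
    have "\<kappa> + (2 * l - \<kappa>) = l + l" using l by simp
    then show ?thesis by (simp flip: power_add)
  qed
  have mult': "2 ^ l' * 2 ^ (l' - 1) = real_of_int (2 ^ \<kappa> * 2 ^ (2 * l' - 1 - \<kappa>))"
  proof -
    have "\<kappa> + (2 * l' - 1 - \<kappa>) = l' + (l' - 1)" using l by simp
    then show ?thesis by (simp flip: power_add)
  qed
  show ?thesis
  proof (cases "0 \<le> s")
    case True
    then have s: "s < 2 ^ l" and s': "2 ^ (l' - 1) \<le> s'"
      using lay sgn unfolding axis_layer_def by (auto intro: order_trans[of _ 0])
    have "2 ^ l * (2 ^ l - s) > 2 ^ \<kappa> - real_of_int c - 1"
      using axis_label_below_multiple[OF lab(1) c(1) mult s] .
    moreover have "2 * (2 ^ l * (2 ^ l - s)) \<le> 2 ^ l' * (2 ^ l - s)" using s by (intro scale) simp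
    moreover have "2 ^ l' * (2 ^ l - s) \<le> 2 ^ l' * (2 ^ (l' - 1) - s)" using bb by simp
    moreover have "2 ^ l' * (s' - 2 ^ (l' - 1)) \<ge> real_of_int c"
      using axis_label_above_multiple[OF lab(2) c(2) mult' s'] .
    moreover have "2 ^ l' * (s' - s) = 2 ^ l' * (s' - 2 ^ (l' - 1)) + 2 ^ l' * (2 ^ (l' - 1) - s)"
      by (simp add: algebra_simps)
    ultimately have "2 ^ l' * (s' - s) > 2 ^ \<kappa> - 1" using cN by linarith
    moreover have "\<bar>s' - s\<bar> = s' - s" using less sgn True by auto
    ultimately show ?thesis by simp
  next
    case False
    have pos: "(0::real) < 2 ^ (l' - 1)" by simp
    have s: "- (2 ^ l) \<le> s" and s': "s' < - (2 ^ (l' - 1))"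
      using lay sgn False pos unfolding axis_layer_def by linarith+
    have mneg: "2 ^ l * (- (2 ^ l)) = real_of_int (2 ^ \<kappa> * (- (2 ^ (2 * l - \<kappa>))))"
      and mneg': "2 ^ l' * (- (2 ^ (l' - 1))) = real_of_int (2 ^ \<kappa> * (- (2 ^ (2 * l' - 1 - \<kappa>))))"
      using mult mult' by simp_all
    have "2 ^ l' * (- (2 ^ (l' - 1)) - s') > 2 ^ \<kappa> - real_of_int c - 1"
      using axis_label_below_multiple[OF lab(2) c(1) mneg' s'] .
    moreover have "2 ^ l * (s - (- (2 ^ l))) \<ge> real_of_int c"
      using axis_label_above_multiple[OF lab(1) c(2) mneg s] .
    moreover have "2 * (2 ^ l * (s - (- (2 ^ l)))) \<le> 2 ^ l' * (s - (- (2 ^ l)))" using s by (intro scale) simp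
    moreover have "2 ^ l' * (s - (- (2 ^ l))) \<le> 2 ^ l' * (s - (- (2 ^ (l' - 1))))" using bb by simp
    moreover have "2 ^ l' * (s - s') = 2 ^ l' * (s - (- (2 ^ (l' - 1)))) + 2 ^ l' * (- (2 ^ (l' - 1)) - s')"
      by (simp add: algebra_simps)
    moreover have "0 \<le> real_of_int c" using c(1) by simp
    ultimately have "2 ^ l' * (s - s') > 2 ^ \<kappa> - 1" by linarith
    moreover have "\<bar>s' - s\<bar> = s - s'" using less sgn False by auto
    ultimately show ?thesis by simp
  qed
qed

section \<open>The union of all cubes with a given label\<close>

text \<open>Layers are bounded by half-open cubes, so membership depends on the signs of coordinates of
  maximal modulus.  Strict dominance of one coordinate removes the ambiguity.\<close>

lemma axis_layer_of_dominant_coordinate: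
  assumes "a \<in> layer l" "l > 0" "\<And>k. k \<noteq> j \<Longrightarrow> \<bar>a $ k\<bar> < \<bar>a $ j\<bar>"
  shows "axis_layer l (a $ j)"
proof -
  have 1: "- (2 ^ l) \<le> a $ j" "a $ j < 2 ^ l" and 2: "a \<notin> centred_cube (2 ^ (l - 1))"
    using assms(1,2) by (auto simp: layer_def centred_cube_def)
  have False if A: "- (2 ^ (l - 1)) \<le> a $ j" "a $ j < 2 ^ (l - 1)"
  proof -
    have "- (2 ^ (l - 1)) \<le> a $ k \<and> a $ k < 2 ^ (l - 1)" for k
      using A assms(3)[of k] by (cases "k = j") auto
    with 2 show False by (simp add: centred_cube_def)
  qed
  with 1 show ?thesis unfolding axis_layer_def by blast
qed

lemma label_unionE:
  assumes "a \<in> label_union p i"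
  obtains l where "p + 2 \<le> l" "a \<in> layer l" "\<And>j. axis_label (p + 4) (i $ j - 1) l (a $ j)"
proof -
  from assms obtain l y where l: "p + 2 \<le> l" "a \<in> layer l"
    "a \<in> dyadic_cube (int l) (\<chi> j. 2 ^ (p + 4) * y $ j + (i $ j - 1))"
    unfolding label_union_def gauss_cubes_def has_label_def by blast
  have "axis_label (p + 4) (i $ j - 1) l (a $ j)" for j
    using l(3) unfolding mem_dyadic_cube_iff axis_label_def
    by (intro exI[of _ "y $ j"]) (simp del: of_int_add of_int_diff of_int_mult of_int_power)
  with l that show thesis by blast
qed

text \<open>The constants leave room.  A labelled point near the second candidate has modulus below
  \<open>M + 5 R + 1 / M\<close> on the axis, hence lies in an interval of length at least
  \<open>1 / (2 (M + 5 R + 1 / M))\<close>, and it suffices that \<open>2\<^sup>p\<^sup>+\<^sup>4 - 1\<close> such lengths exceed the distance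
  \<open>4 R + 1 / M\<close> which the two labelled points can have at most.  This holds
  because \<open>M \<ge> 2\<^sup>p\<^sup>+\<^sup>1 - 1\<close>: the labelled cubes lie outside \<open>[-2\<^sup>p\<^sup>+\<^sup>1, 2\<^sup>p\<^sup>+\<^sup>1)\<^sup>n\<close>, and \<open>x\<close> is
  within distance \<open>1\<close> of one of them.\<close>

lemma label_union_admissible:
  fixes i :: "int ^ 'n"
  assumes p: "p \<ge> 2" and i: "\<And>j. i $ j \<in> {1..2 ^ (p + 4)}"
  shows "admissible_whitney (2 ^ (p + 3) * sqrt (real CARD('n))) (plus_C (label_union p i) (2 ^ p))"
proof (rule admissible_whitneyI)
  let ?A = "label_union p i"
  fix x assume "x \<in> plus_C ?A (2 ^ p)"
  then obtain a where a: "a \<in> ?A" "dist x a < 2 ^ p * gauss_m x"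
    by (auto simp: mem_plus_C_iff)
  define q :: real where "q = 2 ^ p"
  have q4: "4 \<le> q" unfolding q_def using power_increasing[OF p, of "2::real"] by simp
  define M where "M = Max (range (\<lambda>k. \<bar>x $ k\<bar>))"
  have Mge: "\<bar>x $ k\<bar> \<le> M" for k unfolding M_def by (intro Max_ge) auto
  have "M \<in> range (\<lambda>k. \<bar>x $ k\<bar>)" unfolding M_def by (intro Max_in) auto
  then obtain j where j: "M = \<bar>x $ j\<bar>" by auto
  have Mlarge: "2 * q - 1 \<le> M"
  proof -
    obtain l where l: "p + 2 \<le> l" "a \<in> layer l" using a(1) by (rule label_unionE)
    then have "a \<notin> centred_cube (2 ^ (l - 1))" by (auto simp: layer_def)
    then obtain k where "\<not> (- (2 ^ (l - 1)) \<le> a $ k \<and> a $ k < 2 ^ (l - 1))"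
      unfolding centred_cube_def by blast
    then have k: "2 ^ (l - 1) \<le> \<bar>a $ k\<bar>" by linarith
    have "(2::real) ^ (p + 1) \<le> 2 ^ (l - 1)" using l(1) by (intro power_increasing) auto
    with k have k: "2 * q \<le> \<bar>a $ k\<bar>" by (simp add: q_def)
    have xk: "\<bar>a $ k\<bar> - q * gauss_m x \<le> \<bar>x $ k\<bar>"
      using a(2) dist_ge_component[of x k a] unfolding q_def by linarith
    \<comment> \<open>The estimate is used twice: the crude bound \<open>m \<le> 1\<close> shows \<open>\<bar>x\<bar> \<ge> q\<close>, which improves
      the error term from \<open>q\<close> to \<open>1\<close>.\<close>
    have "q * gauss_m x \<le> q * 1" using q4 by (intro mult_left_mono gauss_m_le_1) auto
    with xk k have "q \<le> \<bar>x $ k\<bar>" by simp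
    then have nx: "q \<le> norm x" using component_le_norm_cart[of x k] by linarith
    with q4 have "gauss_m x = 1 / norm x" by (intro gauss_m_eq_inverse_norm) linarith
    moreover have "q / norm x \<le> 1" using nx q4 by (subst divide_le_eq_1_pos) linarith+
    ultimately have "q * gauss_m x \<le> 1" by simp
    with xk k Mge[of k] show ?thesis by linarith
  qed
  with q4 have M: "7 \<le> M" by linarith
  define R where "R = q / M"
  have R: "0 < R" using q4 M by (simp add: R_def)
  have reach: "8 * R \<le> 2 ^ (p + 3) * sqrt (real CARD('n)) * gauss_m x"
  proof -
    have "norm x \<le> sqrt (real CARD('n)) * M" by (rule norm_le_sqrt_card_mult) (rule Mge)
    then have "8 * R * norm x \<le> 8 * R * (sqrt (real CARD('n)) * M)" using R by (intro mult_left_mono) auto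
    also have "\<dots> = 2 ^ (p + 3) * sqrt (real CARD('n))"
      using M by (simp add: R_def q_def power_add)
    finally have *: "8 * R * norm x \<le> 2 ^ (p + 3) * sqrt (real CARD('n))" .
    have nx: "1 \<le> norm x" using component_le_norm_cart[of x j] j M by linarith
    then have "0 < norm x" by linarith
    with * show ?thesis
      by (simp only: gauss_m_eq_inverse_norm[OF nx] times_divide_eq_right mult_1_right pos_le_divide_eq)
  qed
  have trace: "\<exists>s l. axis_label (p + 4) (i $ j - 1) l s \<and> axis_layer l s \<and> p + 2 \<le> l \<and>
      (0 \<le> s \<longleftrightarrow> 0 \<le> x $ j) \<and> \<bar>\<bar>s\<bar> - (M + t)\<bar> < R"
    if t: "2 * R \<le> t" and bad: "outward j t x \<in> plus_C ?A (2 ^ p)" for t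
  proof -
    let ?z = "outward j t x"
    have t0: "0 \<le> t" using t R by linarith
    obtain b where b: "b \<in> ?A" "dist ?z b < q * gauss_m ?z"
      using bad by (auto simp: mem_plus_C_iff q_def)
    obtain l where l: "p + 2 \<le> l" "b \<in> layer l" "axis_label (p + 4) (i $ j - 1) l (b $ j)"
      using label_unionE[OF b(1)] by blast
    have zM: "M \<le> norm ?z"
      using component_le_norm_cart[of x j] norm_le_norm_outward[OF t0, of x j] j by linarith
    have "gauss_m ?z \<le> 1 / M"
    proof -
      have "gauss_m ?z = 1 / norm ?z" using zM M by (intro gauss_m_eq_inverse_norm) linarith
      with zM M show ?thesis by (simp add: frac_le)
    qed
    then have "q * gauss_m ?z \<le> R" using q4 by (simp add: R_def mult_left_mono[of _ "1 / M" q, simplified])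
    with b(2) have d: "\<bar>?z $ k - b $ k\<bar> < R" for k
      using dist_ge_component[of ?z k b] by (meson le_less_trans less_le_trans)
    have bj: "\<bar>\<bar>b $ j\<bar> - (M + t)\<bar> < R" "0 \<le> b $ j \<longleftrightarrow> 0 \<le> x $ j"
      using d[of j] t t0 M R unfolding outward_nth j by (auto split: if_splits)
    have "\<bar>b $ k\<bar> < \<bar>b $ j\<bar>" if "k \<noteq> j" for k
      using d[of k] bj(1) t Mge[of k] that unfolding outward_nth by auto
    with l have "axis_layer l (b $ j)" by (intro axis_layer_of_dominant_coordinate) auto
    with l bj show ?thesis by blast
  qed
  have "\<exists>t. 0 \<le> t \<and> t \<le> 8 * R \<and> outward j t x \<notin> plus_C ?A (2 ^ p)"
  proof (rule ccontr)
    assume neg: "\<not> ?thesis"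
    have uR: "1 / M \<le> R" unfolding R_def using q4 M by (intro divide_right_mono) auto
    have invM: "0 < 1 / M" using M by simp
    \<comment> \<open>A labelled point is found within \<open>R\<close> of each candidate, so the second candidate is
      \<open>2 R + 1 / M\<close> further out in order that the two labelled points differ by more than
      \<open>1 / M\<close>, which is at least the length of an interval in this region.\<close>
    have bad1: "outward j (2 * R) x \<in> plus_C ?A (2 ^ p)" using neg R by auto
    have bad2: "outward j (4 * R + 1 / M) x \<in> plus_C ?A (2 ^ p)"
    proof -
      have "0 \<le> 4 * R + 1 / M" "4 * R + 1 / M \<le> 8 * R" using R uR invM by linarith+
      with neg show ?thesis by blast
    qed
    obtain s l where s: "axis_label (p + 4) (i $ j - 1) l s" "axis_layer l s" "p + 2 \<le> l"
      "0 \<le> s \<longleftrightarrow> 0 \<le> x $ j" "\<bar>\<bar>s\<bar> - (M + 2 * R)\<bar> < R"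
      using trace[OF _ bad1] by auto
    have "2 * R \<le> 4 * R + 1 / M" using R invM by linarith
    from trace[OF this bad2] obtain s' l' where s': "axis_label (p + 4) (i $ j - 1) l' s'" "axis_layer l' s'" "p + 2 \<le> l'"
      "0 \<le> s' \<longleftrightarrow> 0 \<le> x $ j" "\<bar>\<bar>s'\<bar> - (M + (4 * R + 1 / M))\<bar> < R"
      by blast
    let ?U = "2 ^ l' :: real"
    have eq: "\<bar>s' - s\<bar> = \<bar>s'\<bar> - \<bar>s\<bar>" and less: "\<bar>s\<bar> < \<bar>s'\<bar>"
      using s(4,5) s'(4,5) invM by linarith+
    have lo: "1 / M < \<bar>s' - s\<bar>" and hi: "\<bar>s' - s\<bar> < 4 * R + 1 / M"
      unfolding eq using s(5) s'(5) by linarith+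
    have "M \<le> \<bar>s'\<bar>" using s'(5) R invM by linarith
    moreover have U1: "\<bar>s'\<bar> \<le> ?U" using s'(2) unfolding axis_layer_def by linarith
    ultimately have "1 \<le> ?U * (1 / M)" using M by simp
    also have "\<dots> < ?U * \<bar>s' - s\<bar>" using lo by (rule mult_strict_left_mono) simp
    finally have "\<not> ?U * \<bar>s' - s\<bar> < 1" by simp
    moreover have "?U * \<bar>s' - s\<bar> \<le> 2 ^ (p + 4) - 1"
    proof -
      have s'_bound: "\<bar>s'\<bar> \<le> M + 5 * R + 1 / M"
        using less_imp_le[OF s'(5)] unfolding abs_le_iff[of "_ - _"] by linarith
      have "?U = 2 * 2 ^ (l' - 1)" using s'(3) by (cases l') auto
      also have "(2::real) ^ (l' - 1) \<le> \<bar>s'\<bar>" using s'(2) unfolding axis_layer_def by linarith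
      finally have "?U \<le> 2 * \<bar>s'\<bar>" by simp
      also have "\<dots> \<le> 2 * (M + 5 * R + 1 / M)" using s'_bound by (rule mult_left_mono) simp
      finally have "?U \<le> 2 * (M + 5 * R + 1 / M)" .
      then have "?U * \<bar>s' - s\<bar> \<le> 2 * (M + 5 * R + 1 / M) * (4 * R + 1 / M)"
        using hi R M by (intro mult_mono) auto
      also have "\<dots> = 2 * (4 * q + 1) + 2 * (5 * q + 1) * (4 * q + 1) / M\<^sup>2"
        using M by (simp add: R_def field_simps power2_eq_square)
      also have "\<dots> \<le> 16 * q - 1"
      proof -
        have "(2 * q - 1)\<^sup>2 \<le> M\<^sup>2" using Mlarge q4 by (intro power_mono) auto
        then have "(8 * q - 3) * (2 * q - 1)\<^sup>2 \<le> (8 * q - 3) * M\<^sup>2" using q4 by (intro mult_left_mono) auto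
        moreover have "2 * (5 * q + 1) * (4 * q + 1) \<le> (8 * q - 3) * (2 * q - 1)\<^sup>2"
        proof -
          \<comment> \<open>Expanded at \<open>q = 4\<close>, the difference has only positive coefficients.\<close>
          define d where "d = q - 4"
          have "0 \<le> d" and qd: "q = d + 4" using q4 by (simp_all add: d_def)
          then have "(8 * q - 3) * (2 * q - 1)\<^sup>2 - 2 * (5 * q + 1) * (4 * q + 1)
            = 32 * d ^ 3 + 300 * d\<^sup>2 + 866 * d + 707" 
            unfolding qd by (simp add: power2_eq_square power3_eq_cube algebra_simps)
          moreover have "0 \<le> 32 * d ^ 3 + 300 * d\<^sup>2 + 866 * d + 707" using \<open>0 \<le> d\<close> by simp
          ultimately show ?thesis by linarith
        qed
        ultimately have "2 * (5 * q + 1) * (4 * q + 1) / M\<^sup>2 \<le> 8 * q - 3"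
          using M by (simp add: divide_le_eq)
        then show ?thesis by simp
      qed
      also have "16 * q - 1 = 2 ^ (p + 4) - 1" by (simp add: q_def power_add)
      finally show ?thesis .
    qed
    moreover have "?U * \<bar>s' - s\<bar> < 1 \<or> ?U * \<bar>s' - s\<bar> > 2 ^ (p + 4) - 1"
    proof (rule axis_label_gap[OF s(1) s'(1) s(2) s'(2)])
      show "p + 4 + 1 \<le> 2 * l" "p + 4 + 1 \<le> 2 * l'" using s(3) s'(3) p by linarith+
      have "1 \<le> i $ j" "i $ j \<le> 2 ^ (p + 4)" using i[of j] by simp_all
      then show "0 \<le> i $ j - 1" "i $ j - 1 < 2 ^ (p + 4)" by linarith+
    qed (use s(4) s'(4) less in simp_all)
    ultimately show False by linarith
  qed
  then obtain t where "0 \<le> t" "t \<le> 8 * R" "outward j t x \<notin> plus_C ?A (2 ^ p)" by blast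
  with reach show "\<exists>z. z \<notin> plus_C ?A (2 ^ p) \<and>
      dist x z \<le> 2 ^ (p + 3) * sqrt (real CARD('n)) * gauss_m x"
    by (intro exI[of _ "outward j t x"]) (simp add: dist_outward)
qed

theorem theorem2p8:
  fixes p :: nat
  assumes "p \<ge> 2"
  shows "(\<forall>l \<in> {0..p + 1}. \<forall>Q \<in> (gauss_cubes 0 l :: (real ^ 'n) set set).
            admissible_whitney (2 ^ (2 * p + 2) * sqrt (real CARD('n))) (plus_C Q (2 ^ p)))
       \<and> (\<forall>i :: int ^ 'n. (\<forall>j. i $ j \<in> {1..2 ^ (p + 4)}) \<longrightarrow>
            admissible_whitney (2 ^ (p + 3) * sqrt (real CARD('n))) (plus_C (label_union p i) (2 ^ p)))"
  using gauss_cube_admissible label_union_admissible[OF assms] by blast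

end
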